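(* Let $F:\mathbb{R}\to\mathbb{R}$ be a differentiable function and $f=F'$. The conservation laws for the Noether symmetries $T,R,\tilde X,\tilde Y$ of the equation $\Delta_{H^1}u+f(u)=0$ are the following; in particular, each of the stated divergences vanishes for every smooth solution $u$ of the equation. 1. For $T=\frac{\partial}{\partial t}$: $\mathrm{Div}(\tau)=0$, where $\tau=(\tau_1,\tau_2,\tau_3)$ and $$\tau_1=-2yu_t^2-u_xu_t,\qquad \tau_2=2xu_t^2-u_yu_t,$$ $$\tau_3=\tfrac12u_x^2+\tfrac12u_y^2-2(x^2+y^2)u_t^2-F(u).$$ 2. For $R=y\frac{\partial}{\partial x}-x\frac{\partial}{\partial y}$: $\mathrm{Div}(\sigma)=0$, where $\sigma=(\sigma_1,\sigma_2,\sigma_3)$ and $$\sigma_1=-\tfrac12yu_x^2+\tfrac12yu_y^2+2y(x^2+y^2)u_t^2+xu_xu_y-yF(u),$$ $$\sigma_2=-\tfrac12xu_x^2+\tfrac12xu_y^2-2x(x^2+y^2)u_t^2-yu_xu_y+xF(u),$$ $$\sigma_3=-2y^2u_x^2-2x^2u_y^2+4xyu_xu_y-4y(x^2+y^2)u_xu_t+4x(x^2+y^2)u_yu_t.$$ 3. For $\tilde X=\frac{\partial}{\partial x}-2y\frac{\partial}{\partial t}$: $\mathrm{Div}(\chi)=0$, where $\chi=(\chi_1,\chi_2,\chi_3)$ and $$\chi_1=-\tfrac12u_x^2+\tfrac12u_y^2+2(x^2+3y^2)u_t^2+2yu_xu_t-2xu_yu_t-F(u),$$ $$\chi_2=-4xyu_t^2-u_xu_y+2xu_xu_t+2yu_yu_t,$$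 $$\chi_3=-3yu_x^2-yu_y^2+4y(x^2+y^2)u_t^2+2xu_xu_y-4(x^2+y^2)u_xu_t+2yF(u).$$ 4. For $\tilde Y=\frac{\partial}{\partial y}+2x\frac{\partial}{\partial t}$: $\mathrm{Div}(\upsilon)=0$, where $\upsilon=(\upsilon_1,\upsilon_2,\upsilon_3)$ and $$\upsilon_1=-4xyu_t^2-u_xu_y-2xu_xu_t-2yu_yu_t,$$ $$\upsilon_2=\tfrac12u_x^2-\tfrac12u_y^2+2(3x^2+y^2)u_t^2+2yu_xu_t-2xu_yu_t-F(u),$$ $$\upsilon_3=xu_x^2+3xu_y^2-4x(x^2+y^2)u_t^2-2yu_xu_y-4(x^2+y^2)u_yu_t-2xF(u).$$
   Context: Coordinates on $\mathbb{R}^3$ (the Heisenberg group $H^1$) are $(x^1,x^2,x^3)=(x,y,t)$, and $u=u(x,y,t)$ is a smooth real-valued function. The Kohn-Laplace operator is $$\Delta_{H^1}u=u_{xx}+u_{yy}+4(x^2+y^2)u_{tt}+4y\,u_{xt}-4x\,u_{yt}.$$ The equation $\Delta_{H^1}u+f(u)=0$ is the Euler-Lagrange equation of $$\mathcal{L}=\tfrac12u_x^2+\tfrac12u_y^2+2(x^2+y^2)u_t^2+2y\,u_xu_t-2x\,u_yu_t-F(u).$$ For $A=(A_1,A_2,A_3)$ depending on $x,y,t,u$ and derivatives of $u$, $\mathrm{Div}(A)=D_xA_1+D_yA_2+D_tA_3$ with $D_x,D_y,D_t$ total derivatives. A Lie point symmetry $S=\xi^i\frac{\partial}{\partial x^i}+\eta\frac{\partial}{\partial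 u}$ of the equation is a Noether symmetry if $S^{(1)}\mathcal{L}+\mathcal{L}D_i\xi^i=D_i\varphi^i$ identically for some $\varphi=(\varphi^1,\varphi^2,\varphi^3)$, where $S^{(1)}=S+(D_i\eta-(D_i\xi^j)u_j)\frac{\partial}{\partial u_i}$; its conservation law (Noether's theorem) is $D_i\big(\xi^i\mathcal{L}+(\eta-\xi^ju_j)\frac{\partial\mathcal{L}}{\partial u_i}-\varphi^i\big)=0$ on solutions of the equation. *)

theory Defs
  imports "HOL-Analysis.Analysis"
begin

primrec C_k :: "nat \<Rightarrow> ('a::euclidean_space \<Rightarrow> 'b::real_normed_vector) \<Rightarrow> bool" where
  "C_k 0 f \<longleftrightarrow> continuous_on UNIV f"
| "C_k (Suc k) f \<longleftrightarrow> (\<forall>x. f differentiable (at x)) \<and>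
     (\<forall>v. C_k k (\<lambda>x. frechet_derivative f (at x) v))"

definition smooth :: "('a::euclidean_space \<Rightarrow> 'b::real_normed_vector) \<Rightarrow> bool" where
  "smooth f \<longleftrightarrow> (\<forall>k. C_k k f)"

text \<open>
  Points of \<open>real^3\<close> are \<open>q = (x, y, t)\<close>. The jet spaces have the coordinates
  \<open>(q, w)\<close>, \<open>(q, w, p)\<close> and \<open>(q, w, p, H)\<close>, where \<open>w\<close> stands for the value \<open>u\<close>,
  \<open>p $ i\<close> for \<open>u\<^sub>i\<close> and \<open>H $ i $ j\<close> for \<open>u\<^sub>i\<^sub>j\<close>. Actual second order jets have symmetric \<open>H\<close>;
  this is imposed wherever all jets are quantified over.
\<close>

type_synonym jet0 = "(real^3) \<times> real"
type_synonym jet1 = "(real^3) \<times> real \<times> (real^3)"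
type_synonym jet2 = "(real^3) \<times> real \<times> (real^3) \<times> (real^3^3)"

definition partial :: "3 \<Rightarrow> (real^3 \<Rightarrow> real) \<Rightarrow> real^3 \<Rightarrow> real" where
  "partial i u q = frechet_derivative u (at q) (axis i 1)"

definition jet2_of :: "(real^3 \<Rightarrow> real) \<Rightarrow> real^3 \<Rightarrow> jet2" where
  "jet2_of u q = (q, u q, \<chi> i. partial i u q, \<chi> i j. partial i (partial j u) q)"

text \<open>
  Total derivatives \<open>D\<^sub>i = \<partial>/\<partial>x\<^sup>i + u\<^sub>i \<partial>/\<partial>u + u\<^sub>i\<^sub>j \<partial>/\<partial>u\<^sub>j\<close>, first of functions of \<open>(q, w)\<close>, which yields
  functions of the first order jet, then of functions of the first order jet.
\<close>

definition total_deriv0 :: "3 \<Rightarrow> (jet0 \<Rightarrow> real) \<Rightarrow> jet1 \<Rightarrow> real" where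
  "total_deriv0 i g = (\<lambda>(q, w, p). frechet_derivative g (at (q, w)) (axis i 1, p $ i))"

definition total_deriv :: "3 \<Rightarrow> (jet1 \<Rightarrow> real) \<Rightarrow> jet2 \<Rightarrow> real" where
  "total_deriv i A = (\<lambda>(q, w, p, H). frechet_derivative A (at (q, w, p)) (axis i 1, p $ i, H $ i))"

definition total_div :: "(jet1 \<Rightarrow> real^3) \<Rightarrow> jet2 \<Rightarrow> real" where
  "total_div A J = (\<Sum>i\<in>UNIV. total_deriv i (\<lambda>z. A z $ i) J)"

definition kohn_laplace :: "jet2 \<Rightarrow> real" where
  "kohn_laplace = (\<lambda>(q, w, p, H). H $ 1 $ 1 + H $ 2 $ 2 + 4 * ((q $ 1)\<^sup>2 + (q $ 2)\<^sup>2) * H $ 3 $ 3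
     + 4 * q $ 2 * H $ 1 $ 3 - 4 * q $ 1 * H $ 2 $ 3)"

definition heis_eq :: "(real \<Rightarrow> real) \<Rightarrow> jet2 \<Rightarrow> real" where
  "heis_eq f = (\<lambda>(q, w, p, H). kohn_laplace (q, w, p, H) + f w)"

definition smooth_solution :: "(jet2 \<Rightarrow> real) \<Rightarrow> (real^3 \<Rightarrow> real) \<Rightarrow> bool" where
  "smooth_solution E u \<longleftrightarrow> smooth u \<and> (\<forall>q. E (jet2_of u q) = 0)"

definition lagrangian :: "(real \<Rightarrow> real) \<Rightarrow> jet1 \<Rightarrow> real" where
  "lagrangian F = (\<lambda>(q, w, p). 1/2 * (p $ 1)\<^sup>2 + 1/2 * (p $ 2)\<^sup>2
     + 2 * ((q $ 1)\<^sup>2 + (q $ 2)\<^sup>2) * (p $ 3)\<^sup>2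
     + 2 * q $ 2 * p $ 1 * p $ 3 - 2 * q $ 1 * p $ 2 * p $ 3 - F w)"

text \<open>
  A vector field \<open>S = \<xi>\<^sup>i \<partial>/\<partial>x\<^sup>i + \<eta> \<partial>/\<partial>u\<close> on the space of \<open>(q, w)\<close> is given by the pair \<open>\<xi>\<close>, \<open>\<eta>\<close>.
  The functions below are the coefficients of its prolongations,
  \<open>\<zeta>\<^sub>i = D\<^sub>i \<eta> - (D\<^sub>i \<xi>\<^sup>j) u\<^sub>j\<close> and \<open>\<zeta>\<^sub>i\<^sub>j = D\<^sub>j \<zeta>\<^sub>i - (D\<^sub>j \<xi>\<^sup>k) u\<^sub>i\<^sub>k\<close>.
\<close>

definition prolong1 :: "(jet0 \<Rightarrow> real^3) \<Rightarrow> (jet0 \<Rightarrow> real) \<Rightarrow> 3 \<Rightarrow> jet1 \<Rightarrow> real" where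
  "prolong1 \<xi> \<eta> i = (\<lambda>(q, w, p). total_deriv0 i \<eta> (q, w, p)
     - (\<Sum>j\<in>UNIV. total_deriv0 i (\<lambda>y. \<xi> y $ j) (q, w, p) * p $ j))"

definition prolong2 :: "(jet0 \<Rightarrow> real^3) \<Rightarrow> (jet0 \<Rightarrow> real) \<Rightarrow> 3 \<Rightarrow> 3 \<Rightarrow> jet2 \<Rightarrow> real" where
  "prolong2 \<xi> \<eta> i j = (\<lambda>(q, w, p, H). total_deriv j (prolong1 \<xi> \<eta> i) (q, w, p, H)
     - (\<Sum>k\<in>UNIV. total_deriv0 j (\<lambda>y. \<xi> y $ k) (q, w, p) * H $ i $ k))"

definition prolonged_field1 :: "(jet0 \<Rightarrow> real^3) \<Rightarrow> (jet0 \<Rightarrow> real) \<Rightarrow> jet1 \<Rightarrow> jet1" where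
  "prolonged_field1 \<xi> \<eta> = (\<lambda>(q, w, p).
     (\<xi> (q, w), \<eta> (q, w), \<chi> i. prolong1 \<xi> \<eta> i (q, w, p)))"

definition prolonged_field2 :: "(jet0 \<Rightarrow> real^3) \<Rightarrow> (jet0 \<Rightarrow> real) \<Rightarrow> jet2 \<Rightarrow> jet2" where
  "prolonged_field2 \<xi> \<eta> = (\<lambda>(q, w, p, H).
     (\<xi> (q, w), \<eta> (q, w), \<chi> i. prolong1 \<xi> \<eta> i (q, w, p), \<chi> i j. prolong2 \<xi> \<eta> i j (q, w, p, H)))"

text \<open>
  Infinitesimal invariance: \<open>S\<^sup>(\<^sup>2\<^sup>) E = 0\<close> wherever \<open>E = 0\<close>. The derivative of \<open>E\<close> along the prolonged
  field is taken as a directional derivative, since \<open>heis_eq f\<close> need not be differentiable in \<open>w\<close> when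
  \<open>f\<close> is merely some derivative.
\<close>

definition lie_point_symmetry ::
    "(jet2 \<Rightarrow> real) \<Rightarrow> (jet0 \<Rightarrow> real^3) \<Rightarrow> (jet0 \<Rightarrow> real) \<Rightarrow> bool" where
  "lie_point_symmetry E \<xi> \<eta> \<longleftrightarrow> smooth \<xi> \<and> smooth \<eta> \<and>
     (\<forall>q w p H. transpose H = H \<longrightarrow> E (q, w, p, H) = 0 \<longrightarrow>
       ((\<lambda>s. E ((q, w, p, H) + s *\<^sub>R prolonged_field2 \<xi> \<eta> (q, w, p, H)))
          has_real_derivative 0) (at 0))"

definition noether_identity ::
    "(jet1 \<Rightarrow> real) \<Rightarrow> (jet0 \<Rightarrow> real^3) \<Rightarrow> (jet0 \<Rightarrow> real) \<Rightarrow> (jet1 \<Rightarrow> real^3) \<Rightarrow> bool" where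
  "noether_identity L \<xi> \<eta> \<phi> \<longleftrightarrow> (\<forall>z. \<phi> differentiable (at z)) \<and>
     (\<forall>q w p H. transpose H = H \<longrightarrow>
       frechet_derivative L (at (q, w, p)) (prolonged_field1 \<xi> \<eta> (q, w, p))
         + L (q, w, p) * (\<Sum>i\<in>UNIV. total_deriv0 i (\<lambda>y. \<xi> y $ i) (q, w, p))
       = total_div \<phi> (q, w, p, H))"

definition noether_symmetry ::
    "(jet2 \<Rightarrow> real) \<Rightarrow> (jet1 \<Rightarrow> real) \<Rightarrow> (jet0 \<Rightarrow> real^3) \<Rightarrow> (jet0 \<Rightarrow> real) \<Rightarrow> bool" where
  "noether_symmetry E L \<xi> \<eta> \<longleftrightarrow>
     lie_point_symmetry E \<xi> \<eta> \<and> (\<exists>\<phi>. noether_identity L \<xi> \<eta> \<phi>)"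

definition noether_current ::
    "(jet1 \<Rightarrow> real) \<Rightarrow> (jet0 \<Rightarrow> real^3) \<Rightarrow> (jet0 \<Rightarrow> real) \<Rightarrow> (jet1 \<Rightarrow> real^3) \<Rightarrow> jet1 \<Rightarrow> real^3" where
  "noether_current L \<xi> \<eta> \<phi> = (\<lambda>(q, w, p). \<chi> i. \<xi> (q, w) $ i * L (q, w, p)
     + (\<eta> (q, w) - (\<Sum>j\<in>UNIV. \<xi> (q, w) $ j * p $ j))
         * frechet_derivative L (at (q, w, p)) (0, 0, axis i 1)
     - \<phi> (q, w, p) $ i)"

definition conservation_law :: "(jet2 \<Rightarrow> real) \<Rightarrow> (jet1 \<Rightarrow> real^3) \<Rightarrow> bool" where
  "conservation_law E A \<longleftrightarrow> (\<forall>z. A differentiable (at z)) \<and>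
     (\<forall>u q. smooth_solution E u \<longrightarrow> total_div A (jet2_of u q) = 0)"

text \<open>
  \<open>A\<close> is the conserved vector that Noether's theorem attaches to \<open>S\<close> and the potential \<open>\<phi>\<close>, and its
  divergence does vanish on solutions.
\<close>

definition noether_conservation_law ::
    "(jet2 \<Rightarrow> real) \<Rightarrow> (jet1 \<Rightarrow> real) \<Rightarrow> (jet0 \<Rightarrow> real^3) \<Rightarrow> (jet0 \<Rightarrow> real) \<Rightarrow> (jet1 \<Rightarrow> real^3)
      \<Rightarrow> (jet1 \<Rightarrow> real^3) \<Rightarrow> bool" where
  "noether_conservation_law E L \<xi> \<eta> \<phi> A \<longleftrightarrow>
     noether_symmetry E L \<xi> \<eta> \<and> noether_identity L \<xi> \<eta> \<phi> \<and>
     A = noether_current L \<xi> \<eta> \<phi> \<and> conservation_law E A"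

text \<open>The coefficients \<open>\<xi>\<close> of the four fields; all of them have \<open>\<eta> = 0\<close>.\<close>

definition xi_T :: "jet0 \<Rightarrow> real^3" where
  "xi_T = (\<lambda>(q, w). vector [0, 0, 1])"

definition xi_R :: "jet0 \<Rightarrow> real^3" where
  "xi_R = (\<lambda>(q, w). vector [q $ 2, - (q $ 1), 0])"

definition xi_X :: "jet0 \<Rightarrow> real^3" where
  "xi_X = (\<lambda>(q, w). vector [1, 0, - 2 * q $ 2])"

definition xi_Y :: "jet0 \<Rightarrow> real^3" where
  "xi_Y = (\<lambda>(q, w). vector [0, 1, 2 * q $ 1])"

definition tau_T :: "(real \<Rightarrow> real) \<Rightarrow> jet1 \<Rightarrow> real^3" where
  "tau_T F = (\<lambda>(q, u, p). let x = q $ 1; y = q $ 2; ux = p $ 1; uy = p $ 2; ut = p $ 3 in vector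
    [- 2 * y * ut\<^sup>2 - ux * ut,
     2 * x * ut\<^sup>2 - uy * ut,
     1/2 * ux\<^sup>2 + 1/2 * uy\<^sup>2 - 2 * (x\<^sup>2 + y\<^sup>2) * ut\<^sup>2 - F u])"

definition sigma_R :: "(real \<Rightarrow> real) \<Rightarrow> jet1 \<Rightarrow> real^3" where
  "sigma_R F = (\<lambda>(q, u, p). let x = q $ 1; y = q $ 2; ux = p $ 1; uy = p $ 2; ut = p $ 3 in vector
    [- 1/2 * y * ux\<^sup>2 + 1/2 * y * uy\<^sup>2 + 2 * y * (x\<^sup>2 + y\<^sup>2) * ut\<^sup>2 + x * ux * uy - y * F u,
     - 1/2 * x * ux\<^sup>2 + 1/2 * x * uy\<^sup>2 - 2 * x * (x\<^sup>2 + y\<^sup>2) * ut\<^sup>2 - y * ux * uy + x * F u,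
     - 2 * y\<^sup>2 * ux\<^sup>2 - 2 * x\<^sup>2 * uy\<^sup>2 + 4 * x * y * ux * uy
       - 4 * y * (x\<^sup>2 + y\<^sup>2) * ux * ut + 4 * x * (x\<^sup>2 + y\<^sup>2) * uy * ut])"

definition chi_X :: "(real \<Rightarrow> real) \<Rightarrow> jet1 \<Rightarrow> real^3" where
  "chi_X F = (\<lambda>(q, u, p). let x = q $ 1; y = q $ 2; ux = p $ 1; uy = p $ 2; ut = p $ 3 in vector
    [- 1/2 * ux\<^sup>2 + 1/2 * uy\<^sup>2 + 2 * (x\<^sup>2 + 3 * y\<^sup>2) * ut\<^sup>2 + 2 * y * ux * ut - 2 * x * uy * ut - F u,
     - 4 * x * y * ut\<^sup>2 - ux * uy + 2 * x * ux * ut + 2 * y * uy * ut,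
     - 3 * y * ux\<^sup>2 - y * uy\<^sup>2 + 4 * y * (x\<^sup>2 + y\<^sup>2) * ut\<^sup>2 + 2 * x * ux * uy
       - 4 * (x\<^sup>2 + y\<^sup>2) * ux * ut + 2 * y * F u])"

definition upsilon_Y :: "(real \<Rightarrow> real) \<Rightarrow> jet1 \<Rightarrow> real^3" where
  "upsilon_Y F = (\<lambda>(q, u, p). let x = q $ 1; y = q $ 2; ux = p $ 1; uy = p $ 2; ut = p $ 3 in vector
    [- 4 * x * y * ut\<^sup>2 - ux * uy - 2 * x * ux * ut - 2 * y * uy * ut,
     1/2 * ux\<^sup>2 - 1/2 * uy\<^sup>2 + 2 * (3 * x\<^sup>2 + y\<^sup>2) * ut\<^sup>2 + 2 * y * ux * ut - 2 * x * uy * ut - F u,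
     x * ux\<^sup>2 + 3 * x * uy\<^sup>2 - 4 * x * (x\<^sup>2 + y\<^sup>2) * ut\<^sup>2 - 2 * y * ux * uy
       - 4 * (x\<^sup>2 + y\<^sup>2) * uy * ut - 2 * x * F u])"

end

theory Submission
  imports Defs
begin

text \<open>
  Noether's theorem holds in the characteristic form \<open>Div A = (\<eta> - \<xi>\<^sup>j u\<^sub>j) (D\<^sub>i (\<partial>L/\<partial>u\<^sub>i) - \<partial>L/\<partial>u)\<close>, an
  identity on all jets with symmetric \<open>u\<^sub>i\<^sub>j\<close>, and for the present Lagrangian the second factor is the
  Kohn-Laplace equation. The jets of a solution have symmetric \<open>u\<^sub>i\<^sub>j\<close> because second derivatives
  commute. The four fields are affine in \<open>(x, y, t)\<close>, which makes their prolongations linear with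
  constant coefficients, and the invariance conditions become polynomial identities.
\<close>

section \<open>Symmetry of second derivatives\<close>

lemma has_real_derivative_along_line:
  assumes "g differentiable (at (q + s *\<^sub>R v))"
  shows "((\<lambda>s. g (q + s *\<^sub>R v)) has_real_derivative frechet_derivative g (at (q + s *\<^sub>R v)) v) (at s)"
proof -
  let ?D = "frechet_derivative g (at (q + s *\<^sub>R v))"
  have D: "(g has_derivative ?D) (at (q + s *\<^sub>R v))"
    using assms frechet_derivative_works by blast
  have "((\<lambda>s. q + s *\<^sub>R v) has_derivative (\<lambda>h. h *\<^sub>R v)) (at s)"
    by (auto intro!: derivative_eq_intros)
  from has_derivative_compose[OF this D]
  have "((\<lambda>s. g (q + s *\<^sub>R v)) has_derivative (\<lambda>h. ?D (h *\<^sub>R v))) (at s)" .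
  moreover have "?D (h *\<^sub>R v) = ?D v * h" for h
    using linear_scale[OF has_derivative_linear[OF D]] by simp
  ultimately show ?thesis
    by (simp add: has_field_derivative_def)
qed

text \<open>The mean value theorem is applied twice: first along \<open>a\<close> to the increment
  of \<open>u\<close> in direction \<open>b\<close>, which produces a difference of derivatives
  along \<open>a\<close>, then along \<open>b\<close> to that derivative. The point
  \<open>q + s *\<^sub>R a + r *\<^sub>R b\<close> lies in the parallelogram spanned by
  \<open>h *\<^sub>R a\<close> and \<open>h *\<^sub>R b\<close> at \<open>q\<close>.\<close>

lemma second_difference_mean_value:
  fixes u :: "'a::real_normed_vector \<Rightarrow> real"
  assumes u: "\<And>x. u differentiable (at x)"
    and ua: "\<And>x. (\<lambda>x. frechet_derivative u (at x) a) differentiable (at x)"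
    and h: "0 < h"
  obtains s r where "0 < s" "s < h" "0 < r" "r < h"
    "u (q + h *\<^sub>R a + h *\<^sub>R b) - u (q + h *\<^sub>R a) - u (q + h *\<^sub>R b) + u q
      = h\<^sup>2 * frechet_derivative (\<lambda>x. frechet_derivative u (at x) a) (at (q + s *\<^sub>R a + r *\<^sub>R b)) b"
proof -
  let ?ua = "\<lambda>x. frechet_derivative u (at x) a"
  let ?\<phi> = "\<lambda>s. u (q + h *\<^sub>R b + s *\<^sub>R a) - u (q + s *\<^sub>R a)"
  have "(?\<phi> has_real_derivative ?ua (q + h *\<^sub>R b + s *\<^sub>R a) - ?ua (q + s *\<^sub>R a)) (at s)" for s
    by (intro DERIV_diff has_real_derivative_along_line u)
  then obtain s where s: "0 < s" "s < h"
    and 1: "?\<phi> h - ?\<phi> 0 = (h - 0) * (?ua (q + h *\<^sub>R b + s *\<^sub>R a) - ?ua (q + s *\<^sub>R a))"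
    using MVT2[OF h, of ?\<phi> "\<lambda>s. ?ua (q + h *\<^sub>R b + s *\<^sub>R a) - ?ua (q + s *\<^sub>R a)"] by blast
  have "((\<lambda>r. ?ua (q + s *\<^sub>R a + r *\<^sub>R b)) has_real_derivative
      frechet_derivative ?ua (at (q + s *\<^sub>R a + r *\<^sub>R b)) b) (at r)" for r
    by (rule has_real_derivative_along_line) (rule ua)
  then obtain r where r: "0 < r" "r < h"
    and 2: "?ua (q + s *\<^sub>R a + h *\<^sub>R b) - ?ua (q + s *\<^sub>R a + 0 *\<^sub>R b)
      = (h - 0) * frechet_derivative ?ua (at (q + s *\<^sub>R a + r *\<^sub>R b)) b"
    using MVT2[OF h, of "\<lambda>r. ?ua (q + s *\<^sub>R a + r *\<^sub>R b)"
        "\<lambda>r. frechet_derivative ?ua (at (q + s *\<^sub>R a + r *\<^sub>R b)) b"] by blast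
  from s r 1 2 show thesis
    by (intro that[of s r]) (simp_all add: algebra_simps power2_eq_square)
qed

text \<open>The second difference is symmetric in \<open>a\<close> and \<open>b\<close>. Divided by
  the square of the step, it tends to \<open>D a b q\<close>, and with the roles exchanged to
  \<open>D b a q\<close>, so uniqueness of limits identifies the two.\<close>

lemma frechet_derivative_commute:
  fixes u :: "'a::real_normed_vector \<Rightarrow> real"
  defines "D \<equiv> \<lambda>v w x. frechet_derivative (\<lambda>x. frechet_derivative u (at x) v) (at x) w"
  assumes u: "\<And>x. u differentiable (at x)"
    and u': "\<And>v x. (\<lambda>x. frechet_derivative u (at x) v) differentiable (at x)"
    and cont: "\<And>v w. isCont (D v w) q"
  shows "D a b q = D b a q"
proof -
  define h :: "nat \<Rightarrow> real" where "h n = inverse (real (Suc n))" for n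
  have h: "0 < h n" for n by (simp add: h_def)
  have h0: "h \<longlonglongrightarrow> 0" unfolding h_def by (rule LIMSEQ_inverse_real_of_nat)
  let ?\<Delta> = "\<lambda>a b h. u (q + h *\<^sub>R a + h *\<^sub>R b) - u (q + h *\<^sub>R a) - u (q + h *\<^sub>R b) + u q"
  have lim: "(\<lambda>n. ?\<Delta> a b (h n) / (h n)\<^sup>2) \<longlonglongrightarrow> D a b q" for a b
  proof -
    have "\<exists>s r. 0 < s \<and> s < h n \<and> 0 < r \<and> r < h n \<and>
        ?\<Delta> a b (h n) = (h n)\<^sup>2 * D a b (q + s *\<^sub>R a + r *\<^sub>R b)" for n
      unfolding D_def using second_difference_mean_value[OF u u' h] by metis
    then obtain s r where sr: "\<And>n. 0 < s n" "\<And>n. s n < h n" "\<And>n. 0 < r n" "\<And>n. r n < h n"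
      and eq: "\<And>n. ?\<Delta> a b (h n) = (h n)\<^sup>2 * D a b (q + s n *\<^sub>R a + r n *\<^sub>R b)"
      by metis
    \<comment> \<open>The intermediate parameters are squeezed between 0 and \<open>h n\<close>, so
      the intermediate points converge to \<open>q\<close> and continuity of the mixed derivative
      there gives the limit.\<close>
    have "s \<longlonglongrightarrow> 0" "r \<longlonglongrightarrow> 0"
      using sr by (auto intro!: tendsto_sandwich[OF _ _ tendsto_const h0] always_eventually less_imp_le)
    then have "(\<lambda>n. q + s n *\<^sub>R a + r n *\<^sub>R b) \<longlonglongrightarrow> q + 0 *\<^sub>R a + 0 *\<^sub>R b"
      by (intro tendsto_intros)
    then have "(\<lambda>n. D a b (q + s n *\<^sub>R a + r n *\<^sub>R b)) \<longlonglongrightarrow> D a b q"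
      using isCont_tendsto_compose[OF cont] by simp
    then show ?thesis
      using eq h by (simp add: less_imp_neq[symmetric])
  qed
  have "?\<Delta> b a s = ?\<Delta> a b s" for s
    by (simp add: algebra_simps)
  then have "(\<lambda>n. ?\<Delta> a b (h n) / (h n)\<^sup>2) \<longlonglongrightarrow> D b a q"
    using lim[of b a] by (simp only:)
  with lim[of a b] show ?thesis
    by (rule LIMSEQ_unique)
qed

lemma partial_commute:
  assumes "smooth u"
  shows "partial i (partial j u) q = partial j (partial i u) q"
proof -
  have u: "C_k (Suc (Suc 0)) u" using assms unfolding smooth_def by blast
  then have "isCont (\<lambda>x. frechet_derivative (\<lambda>x. frechet_derivative u (at x) v) (at x) w) q" for v w
    by (simp add: continuous_on_eq_continuous_at)
  with u have "frechet_derivative (\<lambda>x. frechet_derivative u (at x) (axis j 1)) (at q) (axis i 1)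
      = frechet_derivative (\<lambda>x. frechet_derivative u (at x) (axis i 1)) (at q) (axis j 1)"
    by (intro frechet_derivative_commute) simp_all
  then show ?thesis
    by (simp add: partial_def[abs_def])
qed

section \<open>Total derivatives and Noether's theorem\<close>

lemma has_derivative_vec_nth [derivative_intros]:
  "(g has_derivative g') F \<Longrightarrow> ((\<lambda>x. g x $ i) has_derivative (\<lambda>x. g' x $ i)) F"
  by (rule bounded_linear.has_derivative[OF bounded_linear_vec_nth])

lemma differentiable_vec_nth:
  assumes "g differentiable F"
  shows "(\<lambda>x. g x $ i) differentiable F"
proof -
  obtain D where "(g has_derivative D) F"
    using assms by (auto simp: differentiable_def)
  from has_derivative_vec_nth[OF this] show ?thesis
    by (rule differentiableI)
qed

lemma differentiable_vec_lambda:
  fixes g :: "'i::finite \<Rightarrow> 'a::real_normed_vector \<Rightarrow> real"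
  assumes "\<And>i. g i differentiable (at x)"
  shows "(\<lambda>x. \<chi> i. g i x) differentiable (at x)"
  by (subst differentiable_componentwise_within) (auto simp: Basis_vec_def inner_axis assms)

lemma total_deriv_eqI:
  assumes "(A has_derivative A') (at (q, w, p))" "A' (axis i 1, p $ i, H $ i) = d"
  shows "total_deriv i A (q, w, p, H) = d"
  unfolding total_deriv_def prod.case frechet_derivative_at[OF assms(1), symmetric] by (rule assms(2))

lemma total_deriv0_eqI:
  assumes "(g has_derivative g') (at (q, w))" "g' (axis i 1, p $ i) = d"
  shows "total_deriv0 i g (q, w, p) = d"
  unfolding total_deriv0_def prod.case frechet_derivative_at[OF assms(1), symmetric] by (rule assms(2))

lemma has_derivative_frechet:
  "g differentiable (at x) \<Longrightarrow> (g has_derivative frechet_derivative g (at x)) (at x)"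
  using frechet_derivative_works by blast

text \<open>This moves \<xi> and \<eta> from the space of \<open>(q, w)\<close> to the first order
  jet space, where they meet \<open>L\<close> and \<open>p\<close> in one product. The second order
  part \<open>H\<close> drops out because the lifted function is constant in
  \<open>p\<close>.\<close>

lemma total_deriv_lift:
  assumes "g differentiable (at (q, w))"
  shows "(\<lambda>z. g (fst z, fst (snd z))) differentiable (at (q, w, p))"
    and "total_deriv i (\<lambda>z. g (fst z, fst (snd z))) (q, w, p, H) = total_deriv0 i g (q, w, p)"
proof -
  have D: "((\<lambda>z. g (fst z, fst (snd z))) has_derivative
      (\<lambda>v. frechet_derivative g (at (q, w)) (fst v, fst (snd v)))) (at (q, w, p))"
  proof -
    have "((\<lambda>z. (fst z, fst (snd z))) has_derivative (\<lambda>v. (fst v, fst (snd v)))) (at (q, w, p))"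
      by (auto intro!: derivative_eq_intros)
    from has_derivative_compose[OF this] has_derivative_frechet[OF assms] show ?thesis
      by simp
  qed
  show "(\<lambda>z. g (fst z, fst (snd z))) differentiable (at (q, w, p))"
    using D by (rule differentiableI)
  show "total_deriv i (\<lambda>z. g (fst z, fst (snd z))) (q, w, p, H) = total_deriv0 i g (q, w, p)"
    by (rule total_deriv_eqI[OF D]) (simp add: total_deriv0_def)
qed

lemma total_deriv_arith:
  assumes "A differentiable (at (q, w, p))" "B differentiable (at (q, w, p))"
  shows "total_deriv i (\<lambda>z. A z + B z) (q, w, p, H) = total_deriv i A (q, w, p, H) + total_deriv i B (q, w, p, H)"
    and "total_deriv i (\<lambda>z. A z - B z) (q, w, p, H) = total_deriv i A (q, w, p, H) - total_deriv i B (q, w, p, H)"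
    and "total_deriv i (\<lambda>z. A z * B z) (q, w, p, H)
      = A (q, w, p) * total_deriv i B (q, w, p, H) + total_deriv i A (q, w, p, H) * B (q, w, p)"
  by (rule total_deriv_eqI, rule has_derivative_add has_derivative_diff has_derivative_mult,
      rule assms[THEN has_derivative_frechet], rule assms[THEN has_derivative_frechet],
      simp add: total_deriv_def)+

lemma total_deriv_sum:
  assumes "\<And>j. j \<in> I \<Longrightarrow> A j differentiable (at (q, w, p))"
  shows "total_deriv i (\<lambda>z. \<Sum>j\<in>I. A j z) (q, w, p, H) = (\<Sum>j\<in>I. total_deriv i (A j) (q, w, p, H))"
  by (rule total_deriv_eqI, rule has_derivative_sum, rule assms[THEN has_derivative_frechet])
    (simp_all add: total_deriv_def)

lemma total_deriv_coordinate:
  shows "(\<lambda>z. snd (snd z) $ j) differentiable (at (q, w, p))"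
    and "total_deriv i (\<lambda>z. snd (snd z) $ j) (q, w, p, H) = H $ i $ j"
proof -
  have D: "((\<lambda>z. snd (snd z) $ j) has_derivative (\<lambda>z. snd (snd z) $ j)) (at (q, w, p))"
    by (auto intro!: derivative_eq_intros)
  show "(\<lambda>z. snd (snd z) $ j) differentiable (at (q, w, p))"
    using D by (rule differentiableI)
  show "total_deriv i (\<lambda>z. snd (snd z) $ j) (q, w, p, H) = H $ i $ j"
    by (rule total_deriv_eqI[OF D]) simp
qed

lemma transpose_eq_nth: "transpose H = H \<Longrightarrow> H $ i $ j = H $ j $ i"
  by (metis transpose_def vec_lambda_beta)

text \<open>Applied to the derivative of \<open>L\<close>, this is the chain rule: it separates the
  partial derivatives by \<open>x\<^sup>i\<close>, \<open>u\<close> and \<open>u\<^sub>i\<close>, so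
  that total derivatives of \<open>L\<close> and its derivative along a prolonged field can be
  compared term by term.\<close>

lemma linear_jet1_expand:
  fixes D :: "jet1 \<Rightarrow> real"
  assumes "linear D"
  shows "D (a, b, c) = (\<Sum>i\<in>UNIV. a $ i * D (axis i 1, 0, 0)) + b * D (0, 1, 0)
    + (\<Sum>i\<in>UNIV. c $ i * D (0, 0, axis i 1))"
proof -
  have "(a, b, c) = (\<Sum>i\<in>UNIV. a $ i *\<^sub>R (axis i 1, 0, 0)) + b *\<^sub>R (0, 1, 0)
      + (\<Sum>i\<in>UNIV. c $ i *\<^sub>R (0, 0, axis i 1))"
    by (simp add: prod_eq_iff fst_sum snd_sum vec_eq_iff sum_3 axis_def forall_3)
  then show ?thesis
    by (simp only: linear_add[OF assms] linear_sum[OF assms] linear_scale[OF assms] real_scaleR_def)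
qed

text \<open>
  Only the \<open>\<partial>L/\<partial>u\<^sub>i\<close> are differentiated again, so \<open>L\<close> need not be twice differentiable in \<open>u\<close>; this
  matters since \<open>F\<close> is merely differentiable.
\<close>

theorem total_div_noether_current:
  fixes L :: "jet1 \<Rightarrow> real"
  defines "Lp \<equiv> \<lambda>i z. frechet_derivative L (at z) (0, 0, axis i 1)"
  assumes L: "L differentiable (at (q, w, p))"
    and Lp: "\<And>i. Lp i differentiable (at (q, w, p))"
    and \<xi>: "\<xi> differentiable (at (q, w))" and \<eta>: "\<eta> differentiable (at (q, w))"
    and \<phi>: "noether_identity L \<xi> \<eta> \<phi>"
    and H: "transpose H = H"
  shows "noether_current L \<xi> \<eta> \<phi> differentiable (at (q, w, p))"
    and "total_div (noether_current L \<xi> \<eta> \<phi>) (q, w, p, H)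
      = (\<eta> (q, w) - (\<Sum>j\<in>UNIV. \<xi> (q, w) $ j * p $ j))
        * ((\<Sum>i\<in>UNIV. total_deriv i (Lp i) (q, w, p, H)) - frechet_derivative L (at (q, w, p)) (0, 1, 0))"
proof -
  let ?z = "(q, w, p)" and ?J = "(q, w, p, H)"
  let ?A = "\<lambda>i z. \<xi> (fst z, fst (snd z)) $ i * L z
    + (\<eta> (fst z, fst (snd z)) - (\<Sum>j\<in>UNIV. \<xi> (fst z, fst (snd z)) $ j * snd (snd z) $ j)) * Lp i z
    - \<phi> z $ i"
  have \<phi>': "\<phi> differentiable (at z)" for z
    using \<phi> unfolding noether_identity_def by blast
  have \<xi>i: "(\<lambda>y. \<xi> y $ j) differentiable (at (q, w))" for j
    using \<xi> by (rule differentiable_vec_nth)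
  have nth: "noether_current L \<xi> \<eta> \<phi> = (\<lambda>z. \<chi> i. ?A i z)"
    by (simp add: noether_current_def Lp_def fun_eq_iff)
  note diff = L Lp total_deriv_lift(1)[OF \<eta>] total_deriv_lift(1)[OF \<xi>i]
    differentiable_vec_nth[OF \<phi>'] total_deriv_coordinate(1)
    differentiable_add differentiable_diff differentiable_mult differentiable_sum
  have "?A i differentiable (at ?z)" for i
    by (intro diff ballI finite)
  then show "noether_current L \<xi> \<eta> \<phi> differentiable (at ?z)"
    unfolding nth by (rule differentiable_vec_lambda)
  \<comment> \<open>Product rule for \<xi>^i L + Q L_{u_i} - \<phi>^i with the characteristic Q =
    \<eta> - \<xi>^j u_j. The bracket before \<open>Lp i ?z\<close> is D_i Q, which equals \<zeta>_i
    - \<xi>^j u_ij in terms of the prolongation coefficient.\<close>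
  have "total_deriv i (\<lambda>z. noether_current L \<xi> \<eta> \<phi> z $ i) ?J
    = (\<xi> (q, w) $ i * total_deriv i L ?J
        + total_deriv0 i (\<lambda>y. \<xi> y $ i) ?z * L ?z
        + ((\<eta> (q, w) - (\<Sum>j\<in>UNIV. \<xi> (q, w) $ j * p $ j)) * total_deriv i (Lp i) ?J
          + (total_deriv0 i \<eta> ?z - (\<Sum>j\<in>UNIV. \<xi> (q, w) $ j * H $ i $ j
              + total_deriv0 i (\<lambda>y. \<xi> y $ j) ?z * p $ j)) * Lp i ?z))
        - total_deriv i (\<lambda>z. \<phi> z $ i) ?J" for i
    unfolding nth vec_lambda_beta
    by (subst total_deriv_arith total_deriv_sum, (intro diff ballI finite; fail)+)+
      (simp add: total_deriv_arith(3)[OF total_deriv_lift(1)[OF \<xi>i] total_deriv_coordinate(1)]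
        total_deriv_lift(2)[OF \<eta>] total_deriv_lift(2)[OF \<xi>i] total_deriv_coordinate(2))
  then have div: "total_div (noether_current L \<xi> \<eta> \<phi>) ?J = (\<Sum>i\<in>UNIV.
      \<xi> (q, w) $ i * total_deriv i L ?J
        + total_deriv0 i (\<lambda>y. \<xi> y $ i) ?z * L ?z
        + ((\<eta> (q, w) - (\<Sum>j\<in>UNIV. \<xi> (q, w) $ j * p $ j)) * total_deriv i (Lp i) ?J
          + (total_deriv0 i \<eta> ?z - (\<Sum>j\<in>UNIV. \<xi> (q, w) $ j * H $ i $ j
              + total_deriv0 i (\<lambda>y. \<xi> y $ j) ?z * p $ j)) * Lp i ?z)) - total_div \<phi> ?J"
    by (simp add: total_div_def sum_subtractf)
  \<comment> \<open>The Noether identity is read from right to left, to trade Div \<phi> for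
    derivatives of \<open>L\<close> and of \<xi>.\<close>
  have id: "total_div \<phi> ?J = frechet_derivative L (at ?z) (prolonged_field1 \<xi> \<eta> ?z)
         + L ?z * (\<Sum>i\<in>UNIV. total_deriv0 i (\<lambda>y. \<xi> y $ i) ?z)"
    using \<phi> H by (simp add: noether_identity_def)
  have lin: "linear (frechet_derivative L (at ?z))"
    using has_derivative_linear[OF has_derivative_frechet[OF L]] .
  note sym = transpose_eq_nth[OF H]
  have axis: "(\<Sum>j\<in>UNIV. axis i 1 $ j * c j) = c i" for i :: 3 and c :: "3 \<Rightarrow> real"
    by (simp add: axis_def if_distrib[of "\<lambda>x. x * _"] cong: if_cong)
  have Lp_eq: "frechet_derivative L (at ?z) (0, 0, axis i 1) = Lp i ?z" for i
    by (simp add: Lp_def)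
  have DL: "total_deriv i L ?J = frechet_derivative L (at ?z) (axis i 1, 0, 0)
      + p $ i * frechet_derivative L (at ?z) (0, 1, 0) + (\<Sum>j\<in>UNIV. H $ i $ j * Lp j ?z)" for i
    unfolding total_deriv_def prod.case
    by (subst linear_jet1_expand[OF lin]) (simp only: axis Lp_def)
  \<comment> \<open>The terms in \<partial>L/\<partial>x^i, in L D_i \<xi>^i and in \<zeta>_i cancel
    directly. The terms \<xi>^i u_ij L_{u_j} and \<xi>^j u_ij L_{u_i} cancel by symmetry of
    \<open>H\<close>. Besides Q D_i L_{u_i} there remains only (\<xi>^i u_i - \<eta>) L_u = -Q
    L_u.\<close>
  show "total_div (noether_current L \<xi> \<eta> \<phi>) ?J
      = (\<eta> (q, w) - (\<Sum>j\<in>UNIV. \<xi> (q, w) $ j * p $ j))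
        * ((\<Sum>i\<in>UNIV. total_deriv i (Lp i) ?J) - frechet_derivative L (at ?z) (0, 1, 0))"
    unfolding div id prolonged_field1_def prolong1_def prod.case
      linear_jet1_expand[OF lin, of "\<xi> (q, w)"] DL
    by (simp add: Lp_eq sum_3 sym[of 2 1] sym[of 3 1] sym[of 3 2] algebra_simps)
qed

section \<open>The Kohn-Laplace equation\<close>

lemma has_derivative_lagrangian:
  assumes F: "(F has_real_derivative f w) (at w)"
  shows "(lagrangian F has_derivative (\<lambda>(a, b, c).
     p $ 1 * c $ 1 + p $ 2 * c $ 2 + 4 * (q $ 1 * a $ 1 + q $ 2 * a $ 2) * (p $ 3)\<^sup>2
       + 4 * ((q $ 1)\<^sup>2 + (q $ 2)\<^sup>2) * p $ 3 * c $ 3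
       + 2 * (a $ 2 * p $ 1 * p $ 3 + q $ 2 * c $ 1 * p $ 3 + q $ 2 * p $ 1 * c $ 3)
       - 2 * (a $ 1 * p $ 2 * p $ 3 + q $ 1 * c $ 2 * p $ 3 + q $ 1 * p $ 2 * c $ 3)
       - f w * b)) (at (q, w, p))"
proof -
  have "(F has_derivative (\<lambda>v. f w * v)) (at (fst (snd (q, w, p))))"
    using F by (simp add: has_field_derivative_def)
  from has_derivative_compose[OF has_derivative_fst[OF has_derivative_snd[OF has_derivative_ident]] this]
  have F': "((\<lambda>z. F (fst (snd z))) has_derivative (\<lambda>v. f w * fst (snd v))) (at (q, w, p))"
    by simp
  have L: "lagrangian F = (\<lambda>z. 1/2 * (snd (snd z) $ 1)\<^sup>2 + 1/2 * (snd (snd z) $ 2)\<^sup>2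
     + 2 * ((fst z $ 1)\<^sup>2 + (fst z $ 2)\<^sup>2) * (snd (snd z) $ 3)\<^sup>2
     + 2 * fst z $ 2 * snd (snd z) $ 1 * snd (snd z) $ 3
     - 2 * fst z $ 1 * snd (snd z) $ 2 * snd (snd z) $ 3 - F (fst (snd z)))"
    by (auto simp: lagrangian_def)
  show ?thesis
    unfolding L
    by (rule has_derivative_eq_rhs, (rule derivative_intros F')+)
      (simp add: fun_eq_iff algebra_simps power2_eq_square)
qed

lemma frechet_derivative_lagrangian:
  assumes "\<And>r. (F has_real_derivative f r) (at r)"
  shows "frechet_derivative (lagrangian F) (at (q, w, p)) (a, b, c) =
     p $ 1 * c $ 1 + p $ 2 * c $ 2 + 4 * (q $ 1 * a $ 1 + q $ 2 * a $ 2) * (p $ 3)\<^sup>2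
       + 4 * ((q $ 1)\<^sup>2 + (q $ 2)\<^sup>2) * p $ 3 * c $ 3
       + 2 * (a $ 2 * p $ 1 * p $ 3 + q $ 2 * c $ 1 * p $ 3 + q $ 2 * p $ 1 * c $ 3)
       - 2 * (a $ 1 * p $ 2 * p $ 3 + q $ 1 * c $ 2 * p $ 3 + q $ 1 * p $ 2 * c $ 3)
       - f w * b"
  by (simp add: frechet_derivative_at[OF has_derivative_lagrangian[where f = f, OF assms], symmetric])

text \<open>The momenta L_{u_i} are polynomials in \<open>q\<close> and \<open>p\<close> free of
  \<open>F\<close>, hence differentiable. The coefficient 4y of u_xt arises as 2y from D_x plus 2y
  from D_t, and -4x of u_yt likewise from D_y and D_t; merging the halves uses symmetry of
  \<open>H\<close>. Since \<open>F\<close> enters the Lagrangian with a minus sign, -L_u contributes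
  \<open>+ f w\<close>.\<close>

lemma euler_lagrange_lagrangian:
  assumes F: "\<And>r. (F has_real_derivative f r) (at r)"
  defines "Lp \<equiv> \<lambda>i z. frechet_derivative (lagrangian F) (at z) (0, 0, axis i 1)"
  shows "Lp i differentiable (at (q, w, p))"
    and "transpose H = H \<Longrightarrow> (\<Sum>i\<in>UNIV. total_deriv i (Lp i) (q, w, p, H))
      - frechet_derivative (lagrangian F) (at (q, w, p)) (0, 1, 0) = heis_eq f (q, w, p, H)"
proof -
  have Lp: "Lp 1 = (\<lambda>z. snd (snd z) $ 1 + 2 * fst z $ 2 * snd (snd z) $ 3)"
    "Lp 2 = (\<lambda>z. snd (snd z) $ 2 - 2 * fst z $ 1 * snd (snd z) $ 3)"
    "Lp 3 = (\<lambda>z. 4 * ((fst z $ 1)\<^sup>2 + (fst z $ 2)\<^sup>2) * snd (snd z) $ 3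
      + 2 * fst z $ 2 * snd (snd z) $ 1 - 2 * fst z $ 1 * snd (snd z) $ 2)"
    by (auto simp: Lp_def frechet_derivative_lagrangian[OF F] axis_def)
  have D1: "(Lp 1 has_derivative (\<lambda>(a, b, c). c $ 1 + 2 * (a $ 2 * p $ 3 + q $ 2 * c $ 3))) (at (q, w, p))"
    and D2: "(Lp 2 has_derivative (\<lambda>(a, b, c). c $ 2 - 2 * (a $ 1 * p $ 3 + q $ 1 * c $ 3))) (at (q, w, p))"
    and D3: "(Lp 3 has_derivative (\<lambda>(a, b, c).
      8 * (q $ 1 * a $ 1 + q $ 2 * a $ 2) * p $ 3 + 4 * ((q $ 1)\<^sup>2 + (q $ 2)\<^sup>2) * c $ 3
      + 2 * (a $ 2 * p $ 1 + q $ 2 * c $ 1) - 2 * (a $ 1 * p $ 2 + q $ 1 * c $ 2))) (at (q, w, p))"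
    unfolding Lp
    by (rule has_derivative_eq_rhs, (rule derivative_intros)+,
        simp add: fun_eq_iff algebra_simps power2_eq_square)+
  show "Lp i differentiable (at (q, w, p))"
    using D1 D2 D3 exhaust_3[of i] by (auto intro: differentiableI)
  assume H: "transpose H = H"
  note sym = transpose_eq_nth[OF H]
  show "(\<Sum>i\<in>UNIV. total_deriv i (Lp i) (q, w, p, H))
      - frechet_derivative (lagrangian F) (at (q, w, p)) (0, 1, 0) = heis_eq f (q, w, p, H)"
    using sym[of 2 1] sym[of 3 1] sym[of 3 2]
    by (simp add: sum_3 total_deriv_eqI[OF D1 refl] total_deriv_eqI[OF D2 refl] total_deriv_eqI[OF D3 refl]
        frechet_derivative_lagrangian[OF F] heis_eq_def kohn_laplace_def axis_def algebra_simps)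
qed

lemma smooth_differentiable:
  assumes "smooth g"
  shows "g differentiable (at x)"
proof -
  have "C_k (Suc 0) g" using assms unfolding smooth_def by blast
  then show ?thesis by simp
qed

text \<open>On solutions the Euler-Lagrange factor in the characteristic form vanishes. What remains
  to be checked for a concrete field is invariance of the equation and the Noether identity.\<close>

lemma noether_conservation_law_lagrangian:
  assumes F: "\<And>r. (F has_real_derivative f r) (at r)"
    and sym: "lie_point_symmetry (heis_eq f) \<xi> \<eta>"
    and id: "noether_identity (lagrangian F) \<xi> \<eta> \<phi>"
  shows "noether_conservation_law (heis_eq f) (lagrangian F) \<xi> \<eta> \<phi> (noether_current (lagrangian F) \<xi> \<eta> \<phi>)"
proof -
  have L: "lagrangian F differentiable (at (q, w, p))" for q w p
    using has_derivative_lagrangian[where f = f, OF F] by (rule differentiableI)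
  have \<xi>: "\<xi> differentiable (at z)" and \<eta>: "\<eta> differentiable (at z)" for z
    using sym by (auto simp: lie_point_symmetry_def intro: smooth_differentiable)
  note noether = total_div_noether_current[OF L euler_lagrange_lagrangian(1)[where f = f, OF F] \<xi> \<eta> id]
  have zero: "total_div (noether_current (lagrangian F) \<xi> \<eta> \<phi>) (jet2_of u q) = 0"
    if u: "smooth_solution (heis_eq f) u" for u q
  proof -
    have T: "transpose (\<chi> i j. partial i (partial j u) q) = (\<chi> i j. partial i (partial j u) q)"
      using partial_commute[of u] u by (simp add: transpose_def vec_eq_iff smooth_solution_def)
    show ?thesis
      using u noether(2)[OF T] euler_lagrange_lagrangian(2)[where f = f, OF F T]
      by (simp add: smooth_solution_def jet2_of_def)
  qed
  \<comment> \<open>A multiple of the identity matrix supplies the symmetric \<open>H\<close> asked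
    for by the general theorem.\<close>
  have "noether_current (lagrangian F) \<xi> \<eta> \<phi> differentiable (at z)" for z
    using noether(1)[OF transpose_mat] by (cases z) simp
  with zero sym id show ?thesis
    by (auto simp: noether_conservation_law_def noether_symmetry_def conservation_law_def)
qed

section \<open>Affine vector fields\<close>

text \<open>Every directional derivative of \<open>g\<close> is a constant function, and constants
  are \<open>C_k\<close> for all \<open>k\<close> by induction, since their derivative is again a
  constant.\<close>

lemma smooth_if_constant_derivative:
  fixes g :: "'a::euclidean_space \<Rightarrow> 'b::real_normed_vector"
  assumes "\<And>x. (g has_derivative A) (at x)"
  shows "smooth g"
proof -
  have const: "C_k k (\<lambda>_::'a. c::'b)" for k c
  proof (induction k arbitrary: c)
    case (Suc k)
    have "frechet_derivative (\<lambda>_::'a. c::'b) (at x) = (\<lambda>_. 0)" for x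
      by (rule frechet_derivative_at[OF has_derivative_const, symmetric])
    with Suc show ?case by simp
  qed simp
  have "frechet_derivative g (at x) = A" for x
    by (rule frechet_derivative_at[OF assms, symmetric])
  with assms const have Suc: "C_k (Suc k) g" for k
    by (auto intro: differentiableI)
  have 0: "C_k 0 g"
    using has_derivative_continuous[OF assms] by (simp add: continuous_at_imp_continuous_on)
  have "C_k k g" for k
    using 0 Suc by (cases k) blast+
  then show ?thesis
    unfolding smooth_def by blast
qed

context
  fixes b :: "real^3" and M :: "real^3^3" and \<xi> :: "jet0 \<Rightarrow> real^3"
  assumes \<xi>: "\<xi> = (\<lambda>(q, w). b + M *v q)"
begin

lemma affine_field_apply: "\<xi> (q, w) = b + M *v q"
  by (simp add: \<xi>)

lemma has_derivative_affine_field: "(\<xi> has_derivative (\<lambda>v. M *v fst v)) (at z)"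
  unfolding \<xi> case_prod_unfold
  by (rule has_derivative_eq_rhs,
      (rule derivative_intros bounded_linear.has_derivative[OF matrix_vector_mul_bounded_linear])+) simp

lemma total_deriv0_affine_field: "total_deriv0 i (\<lambda>y. \<xi> y $ j) = (\<lambda>_. M $ j $ i)"
proof
  fix z :: jet1
  obtain q w p where z: "z = (q, w, p)" by (cases z)
  show "total_deriv0 i (\<lambda>y. \<xi> y $ j) z = M $ j $ i"
    unfolding z by (rule total_deriv0_eqI, rule has_derivative_vec_nth, rule has_derivative_affine_field)
      (simp add: matrix_vector_mul_component inner_axis)
qed

lemma prolong1_affine_field:
  "prolong1 \<xi> (\<lambda>_. 0) i = (\<lambda>z. - (\<Sum>k\<in>UNIV. M $ k $ i * snd (snd z) $ k))"
  by (auto simp: prolong1_def total_deriv0_affine_field total_deriv0_def)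

text \<open>For symmetric \<open>H\<close> the right-hand side is the entry of -(M^T H + H M), the
  infinitesimal change of a Hessian under the linear flow generated by \<open>M\<close>;
  correspondingly the gradient changes by -M^T p.\<close>

lemma prolong2_affine_field:
  "prolong2 \<xi> (\<lambda>_. 0) i j (q, w, p, H)
    = - (\<Sum>k\<in>UNIV. M $ k $ i * H $ j $ k) - (\<Sum>k\<in>UNIV. M $ k $ j * H $ i $ k)"
proof -
  have "((\<lambda>z. - (\<Sum>k\<in>UNIV. M $ k $ i * snd (snd z) $ k)) has_derivative
      (\<lambda>z. - (\<Sum>k\<in>UNIV. M $ k $ i * snd (snd z) $ k))) (at (q, w, p))"
    by (auto intro!: derivative_eq_intros)
  then have "total_deriv j (prolong1 \<xi> (\<lambda>_. 0) i) (q, w, p, H) = - (\<Sum>k\<in>UNIV. M $ k $ i * H $ j $ k)"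
    unfolding prolong1_affine_field by (rule total_deriv_eqI) simp
  then show ?thesis
    by (simp add: prolong2_def total_deriv0_affine_field)
qed

text \<open>Since \<eta> = 0, the value \<open>w\<close> is fixed along the prolonged field, so
  \<open>f w\<close> is a constant and \<open>f\<close> is never differentiated. The premise is the
  derivative of the Kohn-Laplace expression along the field, with \<open>a\<close> the change of
  \<open>q\<close> and \<open>C\<close> that of \<open>H\<close>; it is asked to vanish on all
  symmetric jets, hence in particular on the equation.\<close>

lemma lie_point_symmetry_affine_field:
  assumes "\<And>q p H a C. transpose H = H \<Longrightarrow> a = b + M *v q \<Longrightarrow>
      C = (\<lambda>i j. - (\<Sum>k\<in>UNIV. M $ k $ i * H $ j $ k) - (\<Sum>k\<in>UNIV. M $ k $ j * H $ i $ k)) \<Longrightarrow>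
      C 1 1 + C 2 2 + 8 * (q $ 1 * a $ 1 + q $ 2 * a $ 2) * H $ 3 $ 3
        + 4 * ((q $ 1)\<^sup>2 + (q $ 2)\<^sup>2) * C 3 3
        + 4 * (a $ 2 * H $ 1 $ 3 + q $ 2 * C 1 3) - 4 * (a $ 1 * H $ 2 $ 3 + q $ 1 * C 2 3) = 0"
  shows "lie_point_symmetry (heis_eq f) \<xi> (\<lambda>_. 0)"
  unfolding lie_point_symmetry_def
proof (intro conjI allI impI)
  show "smooth \<xi>"
    by (rule smooth_if_constant_derivative has_derivative_affine_field)+
  show "smooth (\<lambda>_::jet0. 0::real)"
    by (rule smooth_if_constant_derivative has_derivative_const)+
  fix q p :: "real^3" and w :: real and H :: "real^3^3"
  assume H: "transpose H = H"
  define a where "a = b + M *v q"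
  define C where "C = (\<lambda>i j. - (\<Sum>k\<in>UNIV. M $ k $ i * H $ j $ k) - (\<Sum>k\<in>UNIV. M $ k $ j * H $ i $ k))"
  have "((\<lambda>s. (H $ 1 $ 1 + s * C 1 1) + (H $ 2 $ 2 + s * C 2 2)
      + 4 * ((q $ 1 + s * a $ 1)\<^sup>2 + (q $ 2 + s * a $ 2)\<^sup>2) * (H $ 3 $ 3 + s * C 3 3)
      + 4 * (q $ 2 + s * a $ 2) * (H $ 1 $ 3 + s * C 1 3)
      - 4 * (q $ 1 + s * a $ 1) * (H $ 2 $ 3 + s * C 2 3) + f w) has_real_derivative
      C 1 1 + C 2 2 + 8 * (q $ 1 * a $ 1 + q $ 2 * a $ 2) * H $ 3 $ 3
        + 4 * ((q $ 1)\<^sup>2 + (q $ 2)\<^sup>2) * C 3 3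
        + 4 * (a $ 2 * H $ 1 $ 3 + q $ 2 * C 1 3) - 4 * (a $ 1 * H $ 2 $ 3 + q $ 1 * C 2 3)) (at 0)"
    by (auto intro!: derivative_eq_intros simp: algebra_simps)
  moreover have "prolong2 \<xi> (\<lambda>_. 0) i j (q, w, p, H) = C i j" for i j
    by (simp add: C_def prolong2_affine_field)
  ultimately
  show "((\<lambda>s. heis_eq f ((q, w, p, H) + s *\<^sub>R prolonged_field2 \<xi> (\<lambda>_. 0) (q, w, p, H)))
      has_real_derivative 0) (at 0)"
    using assms[OF H a_def C_def]
    by (simp add: heis_eq_def kohn_laplace_def prolonged_field2_def affine_field_apply flip: a_def)
qed

text \<open>Trace zero means that \<xi> is divergence free, which removes L D_i \<xi>^i, and \<eta>
  = 0 removes the contribution of \<open>F\<close>. The premise \<open>inv\<close> then says that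
  the quadratic part of the Lagrangian is invariant, so the potential can be zero.\<close>

lemma noether_identity_affine_field:
  assumes F: "\<And>r. (F has_real_derivative f r) (at r)"
    and tr: "(\<Sum>i\<in>UNIV. M $ i $ i) = 0"
    and inv: "\<And>q p a c. a = b + M *v q \<Longrightarrow> c = (\<lambda>i. - (\<Sum>k\<in>UNIV. M $ k $ i * p $ k)) \<Longrightarrow>
      p $ 1 * c 1 + p $ 2 * c 2 + 4 * (q $ 1 * a $ 1 + q $ 2 * a $ 2) * (p $ 3)\<^sup>2
       + 4 * ((q $ 1)\<^sup>2 + (q $ 2)\<^sup>2) * p $ 3 * c 3
       + 2 * (a $ 2 * p $ 1 * p $ 3 + q $ 2 * c 1 * p $ 3 + q $ 2 * p $ 1 * c 3)
       - 2 * (a $ 1 * p $ 2 * p $ 3 + q $ 1 * c 2 * p $ 3 + q $ 1 * p $ 2 * c 3) = 0"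
  shows "noether_identity (lagrangian F) \<xi> (\<lambda>_. 0) (\<lambda>_. 0)"
proof -
  have "total_div (\<lambda>_. 0) J = 0" for J
    by (cases J) (simp add: total_div_def total_deriv_def)
  with inv[OF refl refl] show ?thesis
    by (simp add: noether_identity_def total_deriv0_affine_field tr prolonged_field1_def
        frechet_derivative_lagrangian[OF F] prolong1_affine_field affine_field_apply)
qed

end

text \<open>Here \<open>Q\<close> is the characteristic of a field with \<eta> = 0, and the factors
  multiplying it are the three momenta L_{u_i}.\<close>

lemma noether_current_lagrangian:
  assumes F: "\<And>r. (F has_real_derivative f r) (at r)"
  shows "noether_current (lagrangian F) \<xi> (\<lambda>_. 0) (\<lambda>_. 0) (q, w, p) =
    (let L = lagrangian F (q, w, p); Q = - (\<Sum>j\<in>UNIV. \<xi> (q, w) $ j * p $ j) in vector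
      [\<xi> (q, w) $ 1 * L + Q * (p $ 1 + 2 * q $ 2 * p $ 3),
       \<xi> (q, w) $ 2 * L + Q * (p $ 2 - 2 * q $ 1 * p $ 3),
       \<xi> (q, w) $ 3 * L + Q * (4 * ((q $ 1)\<^sup>2 + (q $ 2)\<^sup>2) * p $ 3 + 2 * q $ 2 * p $ 1 - 2 * q $ 1 * p $ 2)])"
  by (simp add: noether_current_def vec_eq_iff forall_3 frechet_derivative_lagrangian[OF F] axis_def Let_def)

theorem theorem5:
  fixes F f :: "real \<Rightarrow> real"
  assumes "\<And>r. (F has_real_derivative f r) (at r)"
  shows "noether_conservation_law (heis_eq f) (lagrangian F) xi_T (\<lambda>_. 0) (\<lambda>_. 0) (tau_T F) \<and>
         noether_conservation_law (heis_eq f) (lagrangian F) xi_R (\<lambda>_. 0) (\<lambda>_. 0) (sigma_R F) \<and>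
         noether_conservation_law (heis_eq f) (lagrangian F) xi_X (\<lambda>_. 0) (\<lambda>_. 0) (chi_X F) \<and>
         noether_conservation_law (heis_eq f) (lagrangian F) xi_Y (\<lambda>_. 0) (\<lambda>_. 0) (upsilon_Y F)"
proof -
  note current = noether_current_lagrangian[where f = f, OF assms]
  \<comment> \<open>The linear part \<open>M\<close> is zero for T, a rotation generator in the (x,
    y) plane for R, and a shear feeding y or x into the t component for the other two; all four
    matrices have trace zero.\<close>
  have T: "xi_T = (\<lambda>(q, w). vector [0, 0, 1] + vector [vector [0, 0, 0], vector [0, 0, 0], vector [0, 0, 0]] *v q)"
    and R: "xi_R = (\<lambda>(q, w). 0 + vector [vector [0, 1, 0], vector [-1, 0, 0], vector [0, 0, 0]] *v q)"
    and X: "xi_X = (\<lambda>(q, w). vector [1, 0, 0] + vector [vector [0, 0, 0], vector [0, 0, 0], vector [0, -2, 0]] *v q)"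
    and Y: "xi_Y = (\<lambda>(q, w). vector [0, 1, 0] + vector [vector [0, 0, 0], vector [0, 0, 0], vector [2, 0, 0]] *v q)"
    by (auto simp: xi_T_def xi_R_def xi_X_def xi_Y_def vec_eq_iff forall_3 matrix_vector_mult_def sum_3)
  \<comment> \<open>The polynomial identities hold because the Kohn-Laplace operator is X^2 + Y^2
    with X = \<partial>_x + 2y \<partial>_t and Y = \<partial>_y - 2x \<partial>_t. The fields given
    by \<open>xi_T\<close>, \<open>xi_X\<close> and \<open>xi_Y\<close> commute with X and Y, while
    R satisfies [R, X] = Y and [R, Y] = -X.\<close>
  have lie: "lie_point_symmetry (heis_eq f) xi_T (\<lambda>_. 0)" "lie_point_symmetry (heis_eq f) xi_R (\<lambda>_. 0)"
    "lie_point_symmetry (heis_eq f) xi_X (\<lambda>_. 0)" "lie_point_symmetry (heis_eq f) xi_Y (\<lambda>_. 0)"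
    by (rule lie_point_symmetry_affine_field, rule T R X Y,
       frule transpose_eq_nth[of _ 2 1], frule transpose_eq_nth[of _ 3 1], drule transpose_eq_nth[of _ 3 2],
       simp add: matrix_vector_mult_def sum_3 algebra_simps)+
  \<comment> \<open>The same commutation relations apply, as the Lagrangian is ((Xu)^2 + (Yu)^2)/2 -
    F(u).\<close>
  have id: "noether_identity (lagrangian F) xi_T (\<lambda>_. 0) (\<lambda>_. 0)" "noether_identity (lagrangian F) xi_R (\<lambda>_. 0) (\<lambda>_. 0)"
    "noether_identity (lagrangian F) xi_X (\<lambda>_. 0) (\<lambda>_. 0)" "noether_identity (lagrangian F) xi_Y (\<lambda>_. 0) (\<lambda>_. 0)"
    by (rule noether_identity_affine_field, rule T R X Y, rule assms,
       simp_all add: matrix_vector_mult_def sum_3 algebra_simps power2_eq_square)+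
  note law = lie[THEN noether_conservation_law_lagrangian[where f = f, OF assms]]
  \<comment> \<open>With the momenta inserted, both sides are polynomials in x, y, the first
    derivatives of u and F(u), compared component by component.\<close>
  have "tau_T F = noether_current (lagrangian F) xi_T (\<lambda>_. 0) (\<lambda>_. 0)"
    "sigma_R F = noether_current (lagrangian F) xi_R (\<lambda>_. 0) (\<lambda>_. 0)"
    "chi_X F = noether_current (lagrangian F) xi_X (\<lambda>_. 0) (\<lambda>_. 0)"
    "upsilon_Y F = noether_current (lagrangian F) xi_Y (\<lambda>_. 0) (\<lambda>_. 0)"
    by (simp add: fun_eq_iff current, simp add: lagrangian_def tau_T_def sigma_R_def chi_X_def upsilon_Y_def xi_T_def xi_R_def
        xi_X_def xi_Y_def Let_def vec_eq_iff forall_3 sum_3 algebra_simps power2_eq_square)+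
  then show ?thesis
    using law(1)[OF id(1)] law(2)[OF id(2)] law(3)[OF id(3)] law(4)[OF id(4)] by simp
qed

end
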